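(* Let $(\mathbf\Gamma,o)$ be a finite simple rooted graph with $\deg(o)\ge1$. Let $A_N$ be the adjacency matrix of the $N$-fold star product graph $(\mathbf\Gamma,o)\circledast(\mathbf\Gamma,o)\circledast\cdots\circledast(\mathbf\Gamma,o)$. Let $\lambda_N$ and $\mu_N$ be the largest and smallest eigenvalues of $(\deg(o)N)^{-1/2}A_N$, respectively. Then: (i) the multiplicities of $\lambda_N$ and $\mu_N$ are both one for sufficiently large $N$; (ii) $\lambda_N\to1$ and $\mu_N\to-1$ as $N\to\infty$; (iii) the remaining eigenvalues accumulate around $0$: $$\lim_{N\to\infty}\ \sup\bigl\{|x|: x\in\operatorname{spec}\bigl((\deg(o)N)^{-1/2}A_N\bigr)\setminus\{\lambda_N,\mu_N\}\bigr\}=0$$ (with $\sup\emptyset=0$).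
   Context: Graphs are finite, undirected, without loops or multiple edges. The star product $(\mathbf\Gamma_1,o_1)\circledast(\mathbf\Gamma_2,o_2)$ of rooted graphs $(V_i,E_i,o_i)$ is the rooted graph obtained by gluing the two graphs together at their roots: its vertex set is $\{(x_1,o_2):x_1\in V_1\}\cup\{(o_1,x_2):x_2\in V_2\}\subseteq V_1\times V_2$, its root is $(o_1,o_2)$, and $(x_1,x_2)$, $(y_1,y_2)$ are adjacent iff either $x_1y_1\in E_1$ and $x_2=y_2=o_2$, or $x_1=y_1=o_1$ and $x_2y_2\in E_2$. The star product is associative, so the $N$-fold product is well defined. *)

theory Defs
  imports
    "Graph_Theory.Pair_Digraph"
    "Jordan_Normal_Form.Spectral_Radius"
begin

text \<open>
  A finite simple undirected graph is an instance of \<^locale>\<open>pair_graph\<close>: finite, loop-free,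
  without parallel arcs, and with a symmetric arc relation, so that an edge \<open>xy\<close> is the pair of arcs
  \<open>(x, y)\<close>, \<open>(y, x)\<close>. The degree of a vertex is then its \<^const>\<open>out_degree\<close>.
  The second component of a rooted graph is its root.
\<close>

type_synonym 'a rooted_graph = "'a pair_pre_digraph \<times> 'a"

definition star_product :: "'a rooted_graph \<Rightarrow> 'b rooted_graph \<Rightarrow> ('a \<times> 'b) rooted_graph" where
  "star_product = (\<lambda>(G1, o1) (G2, o2).
     (\<lparr> pverts = {(x, o2) | x. x \<in> pverts G1} \<union> {(o1, y) | y. y \<in> pverts G2},
        parcs = {((x1, x2), (y1, y2)).
                   ((x1, y1) \<in> parcs G1 \<and> x2 = o2 \<and> y2 = o2) \<or>
                   (x1 = o1 \<and> y1 = o1 \<and> (x2, y2) \<in> parcs G2)} \<rparr>,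
      (o1, o2)))"

definition relabel :: "('a \<Rightarrow> 'b) \<Rightarrow> 'a rooted_graph \<Rightarrow> 'b rooted_graph" where
  "relabel f = (\<lambda>(G, r).
     (\<lparr> pverts = f ` pverts G, parcs = map_prod f f ` parcs G \<rparr>, f r))"

text \<open>
  The vertices of the \<open>N\<close>-fold star product are \<open>N\<close>-tuples. To let \<open>N\<close> vary within one type, the tuple
  \<open>(x\<^sub>1, \<dots>, x\<^sub>N)\<close> is represented by a list of length \<open>N\<close>; the relabelling turns
  \<open>(x\<^sub>1, (x\<^sub>2, \<dots>, x\<^sub>N))\<close> into \<open>(x\<^sub>1, \<dots>, x\<^sub>N)\<close>. The empty product is the one-vertex graph, which is
  the unit of the star product.
\<close>

fun star_power :: "'a rooted_graph \<Rightarrow> nat \<Rightarrow> 'a list rooted_graph" where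
  "star_power R 0 = (\<lparr> pverts = {[]}, parcs = {} \<rparr>, [])"
| "star_power R (Suc N) = relabel (\<lambda>(x, xs). x # xs) (star_product R (star_power R N))"

text \<open>The list \<open>vs\<close> fixes the order in which the vertices index rows and columns.\<close>

definition adjacency_matrix :: "'a pair_pre_digraph \<Rightarrow> 'a list \<Rightarrow> real mat" where
  "adjacency_matrix G vs =
     mat (length vs) (length vs) (\<lambda>(i, j). if (vs ! i, vs ! j) \<in> parcs G then 1 else 0)"

end

theory Submission
  imports Defs
begin

text \<open>
  Let \<open>k = deg(o) N\<close>, which is the degree of the root in the \<open>N\<close>-fold star product. The edges at
  the root form a star with \<open>k\<close> leaves, and its adjacency matrix has the simple eigenvalues
  \<open>\<plusminus>sqrt k\<close>, all others being \<open>0\<close>. Deleting the root leaves \<open>N\<close> disjoint copies of one fixed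
  graph, so the remaining edges form a graph whose degrees are at most the number \<open>K\<close> of vertices
  of \<open>\<Gamma>\<close>, whatever \<open>N\<close> is; its adjacency matrix has norm at most \<open>K\<close>. After division by \<open>sqrt k\<close>
  the matrix is therefore a star matrix with eigenvalues \<open>1\<close>, \<open>-1\<close> and \<open>0\<close>, plus a perturbation of
  norm at most \<open>\<epsilon> = K / sqrt k\<close>, and \<open>\<epsilon>\<close> tends to \<open>0\<close>.

  Weyl's inequalities then place, with multiplicity, one eigenvalue within \<open>\<epsilon>\<close> of \<open>1\<close>, one within
  \<open>\<epsilon>\<close> of \<open>-1\<close>, and all others within \<open>\<epsilon>\<close> of \<open>0\<close>. The instance needed,
  \<open>one_eigenvalue_above_hyperplane_bound\<close>, follows from quadratic forms alone: two eigenvalues above \<open>\<epsilon>\<close>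
  would give a plane on which the form is too large, but this plane contains a vector orthogonal to
  the top eigenvector of the star. Multiplicities are algebraic, as orders of roots of the
  characteristic polynomial; the spectral theorem for real symmetric matrices,
  \<open>real_symmetric_orthogonally_diagonalizable\<close>, turns them into numbers of diagonal entries.
  The estimate for the star is \<open>near_star_matrix_spectrum\<close>, and the degrees in the star product come
  from \<open>star_power_root_neighbours\<close> and \<open>star_power_other_degree_le\<close>.
\<close>

section \<open>The spectral theorem for real symmetric matrices\<close>

text \<open>
  The complexified matrix has an eigenvalue \<open>k\<close> with an eigenvector \<open>z\<close>; symmetry makes the
  hermitian form \<open>z\<^sup>* A z = k |z|\<^sup>2\<close> real, so \<open>k\<close> is real and is already a root of the real
  characteristic polynomial.
\<close>

lemma real_symmetric_eigenvector_exists: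
  fixes A :: "real mat"
  assumes A: "A \<in> carrier_mat n n" and sym: "A\<^sup>T = A" and n: "n \<noteq> 0"
  shows "\<exists>v e. eigenvector A v e"
proof -
  let ?A = "map_mat complex_of_real A"
  have cA: "?A \<in> carrier_mat n n" using A by simp
  obtain k where k: "eigenvalue ?A k"
    using spectrum_non_empty[OF cA] n unfolding spectrum_def by auto
  obtain z where z: "z \<in> carrier_vec n" "z \<noteq> 0\<^sub>v n" and Az: "?A *\<^sub>v z = k \<cdot>\<^sub>v z"
    using k A unfolding eigenvalue_def eigenvector_def by auto
  have cz: "conjugate z \<in> carrier_vec n" using z by simp
  have symA: "?A\<^sup>T = ?A" using arg_cong[OF sym, of "map_mat complex_of_real"]
    by (metis map_mat_transpose)
  have conjA: "conjugate (?A *\<^sub>v z) = ?A *\<^sub>v conjugate z"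
    by (rule eq_vecI) (use A z in \<open>auto simp: scalar_prod_def conjugate_complex_def cnj_sum\<close>)
  have "(?A *\<^sub>v z) \<bullet>c z = z \<bullet> (?A *\<^sub>v conjugate z)"
    using transpose_vec_mult_scalar[OF cA cz z(1)] comm_scalar_prod symA z cA by simp
  also have "\<dots> = z \<bullet>c (?A *\<^sub>v z)" using conjA by simp
  finally have "k * (z \<bullet>c z) = cnj k * (z \<bullet>c z)"
    using z by (simp add: Az conjugate_smult_vec)
  moreover have "z \<bullet>c z \<noteq> 0" using z by simp
  ultimately have "k = cnj k" by simp
  hence "k = of_real (Re k)" by (simp add: complex_eq_iff)
  moreover have "poly (char_poly ?A) k = 0" using k eigenvalue_root_char_poly[OF cA] by simp
  ultimately have "poly (char_poly A) (Re k) = 0"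
    unfolding of_real_hom.char_poly_hom[OF A]
    by (metis of_real_hom.poly_map_poly of_real_eq_0_iff)
  thus ?thesis using eigenvalue_root_char_poly[OF A] unfolding eigenvalue_def by blast
qed

text \<open>
  Gram-Schmidt with a final normalization. Columns that are merely orthogonal would not do for
  deflation: the inverse of \<open>W\<close> must be \<open>W\<^sup>T\<close>, so that \<open>W\<^sup>T A W\<close> is at the same time symmetric
  and similar to \<open>A\<close>.
\<close>

lemma orthonormal_basis_extending:
  fixes v :: "real vec"
  assumes v: "v \<in> carrier_vec n" "v \<noteq> 0\<^sub>v n"
  shows "\<exists>W c. W \<in> carrier_mat n n \<and> W\<^sup>T * W = 1\<^sub>m n \<and> col W 0 = c \<cdot>\<^sub>v v"
proof -
  interpret cof_vec_space n "TYPE(real)" .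
  define b where "b = basis_completion v"
  define ws where "ws = gram_schmidt n b"
  from basis_completion[OF v, folded b_def]
  have b: "span (set b) = carrier_vec n" "distinct b" "\<not> lin_dep (set b)"
    "set b \<subseteq> carrier_vec n" "hd b = v" "length b = n" by auto
  have n: "n \<noteq> 0" using v by (auto intro: eq_vecI)
  obtain vs where bv: "b = v # vs" using b n by (cases b) auto
  from gram_schmidt_result[OF b(4) b(2) b(3) refl, folded ws_def]
  have ws: "set ws \<subseteq> carrier_vec n" "corthogonal ws" "length ws = n" by (auto simp: b)
  have hdws: "ws ! 0 = v" using gram_schmidt_hd[OF v(1), of vs, folded bv] ws n
    by (metis hd_conv_nth length_0_conv ws_def)
  define g where "g w = (1 / sqrt (w \<bullet> w)) \<cdot>\<^sub>v w" for w :: "real vec"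
  define W where "W = mat_of_cols n (map g ws)"
  have W: "W \<in> carrier_mat n n" using ws by (simp add: W_def carrier_matI)
  have c: "ws ! i \<in> carrier_vec n" if "i < n" for i using ws that by auto
  have colW: "col W i = g (ws ! i)" if "i < n" for i
    using that ws c[OF that] unfolding W_def by (subst col_mat_of_cols) (auto simp: g_def)
  have "W\<^sup>T * W = 1\<^sub>m n"
  proof (rule eq_matI)
    fix i j assume "i < dim_row (1\<^sub>m n :: real mat)" "j < dim_col (1\<^sub>m n :: real mat)"
    hence i: "i < n" and j: "j < n" by auto
    have orth: "ws ! i \<bullet> ws ! j = 0 \<longleftrightarrow> i \<noteq> j"
      using corthogonalD[OF ws(2), of i j] i j ws(3) by simp
    have pos: "ws ! i \<bullet> ws ! i \<ge> 0" unfolding scalar_prod_def by (auto intro!: sum_nonneg)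
    have "(W\<^sup>T * W) $$ (i, j) = g (ws ! i) \<bullet> g (ws ! j)"
      using i j W by (simp add: colW)
    also have "\<dots> = (ws ! i \<bullet> ws ! j) / (sqrt (ws ! i \<bullet> ws ! i) * sqrt (ws ! j \<bullet> ws ! j))"
      using c[OF i] c[OF j] by (simp add: g_def)
    also have "\<dots> = (1\<^sub>m n) $$ (i, j)" using i j orth pos by auto
    finally show "(W\<^sup>T * W) $$ (i, j) = (1\<^sub>m n) $$ (i, j)" .
  qed (use W in auto)
  thus ?thesis using W colW[of 0] n hdws unfolding g_def by auto
qed

text \<open>
  Induction by deflation: in an orthonormal basis that begins with an eigenvector, the first column
  of the matrix is a multiple of the first unit vector, and by symmetry so is the first row. What
  remains is a symmetric block of size one less.
\<close>

theorem real_symmetric_orthogonally_diagonalizable: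
  fixes A :: "real mat"
  assumes "A \<in> carrier_mat n n" and "A\<^sup>T = A"
  shows "\<exists>P D. P \<in> carrier_mat n n \<and> D \<in> carrier_mat n n \<and> P\<^sup>T * P = 1\<^sub>m n \<and>
           P\<^sup>T * A * P = D \<and> diagonal_mat D"
  using assms
proof (induction n arbitrary: A)
  case 0
  show ?case
    by (rule exI[of _ "1\<^sub>m 0"], rule exI[of _ "0\<^sub>m 0 0"]) (use 0 in \<open>auto simp: diagonal_mat_def\<close>)
next
  case (Suc n)
  note A = Suc.prems(1) and sym = Suc.prems(2)
  obtain v e where ev: "eigenvector A v e"
    using real_symmetric_eigenvector_exists[OF A sym] by blast
  hence v: "v \<in> carrier_vec (Suc n)" "v \<noteq> 0\<^sub>v (Suc n)" and Av: "A *\<^sub>v v = e \<cdot>\<^sub>v v"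
    using A unfolding eigenvector_def by auto
  obtain W c where W: "W \<in> carrier_mat (Suc n) (Suc n)" and WW: "W\<^sup>T * W = 1\<^sub>m (Suc n)"
    and W0: "col W 0 = c \<cdot>\<^sub>v v" using orthonormal_basis_extending[OF v] by blast
  define A' where "A' = W\<^sup>T * A * W"
  have A': "A' \<in> carrier_mat (Suc n) (Suc n)" using A W by (simp add: A'_def)
  have WT: "W\<^sup>T \<in> carrier_mat (Suc n) (Suc n)" using W by simp
  have symA': "A'\<^sup>T = A'"
    using A W sym WT unfolding A'_def
    by (simp add: transpose_mult[of _ "Suc n" "Suc n" _ "Suc n"] assoc_mult_mat[of _ "Suc n" "Suc n" _ "Suc n" _ "Suc n"])
  have A'0: "A' $$ (i, 0) = (if i = 0 then e else 0)" if i: "i < Suc n" for i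
  proof -
    have "A' $$ (i, 0) = (W\<^sup>T * (A * W)) $$ (i, 0)" using A W WT by (simp add: A'_def)
    also have "\<dots> = col W i \<bullet> (A *\<^sub>v col W 0)" using i A W by (simp add: mult_mat_vec_def)
    also have "A *\<^sub>v col W 0 = e \<cdot>\<^sub>v col W 0"
      unfolding W0 using A v Av by (simp add: mult_mat_vec smult_smult_assoc mult.commute)
    also have "col W i \<bullet> (e \<cdot>\<^sub>v col W 0) = e * (W\<^sup>T * W) $$ (i, 0)" using i W by simp
    finally show ?thesis using i by (simp add: WW)
  qed
  define A3 where "A3 = mat n n (\<lambda>(i, j). A' $$ (Suc i, Suc j))"
  have A3: "A3 \<in> carrier_mat n n" by (simp add: A3_def)
  have sA': "A' $$ (i, j) = A' $$ (j, i)" if "i < Suc n" "j < Suc n" for i j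
    using that A' symA' by (metis carrier_matD index_transpose_mat(1))
  have "A3\<^sup>T = A3" by (rule eq_matI) (auto simp: A3_def sA')
  from Suc.IH[OF A3 this] obtain P D where P: "P \<in> carrier_mat n n" and D: "D \<in> carrier_mat n n"
    and PP: "P\<^sup>T * P = 1\<^sub>m n" and PAP: "P\<^sup>T * A3 * P = D" and diag: "diagonal_mat D" by blast
  let ?z = "0\<^sub>m 1 n :: real mat" and ?z' = "0\<^sub>m n 1 :: real mat"
  let ?e = "e \<cdot>\<^sub>m 1\<^sub>m 1"
  define Q where "Q = four_block_mat (1\<^sub>m 1) ?z ?z' P"
  have Q: "Q \<in> carrier_mat (Suc n) (Suc n)" using P by (auto simp: Q_def)
  have QT: "Q\<^sup>T = four_block_mat (1\<^sub>m 1) ?z ?z' (P\<^sup>T)"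
    unfolding Q_def by (subst transpose_four_block_mat) (use P in auto)
  have A'b: "A' = four_block_mat ?e ?z ?z' A3"
    by (rule eq_matI) (use A' A'0 sA'[of 0] in \<open>auto simp: A3_def\<close>)
  have QQ: "Q\<^sup>T * Q = 1\<^sub>m (Suc n)"
    unfolding QT unfolding Q_def
    by (subst mult_four_block_mat[of _ 1 1 _ n _ n _ _ 1 _ n]) (use P PP in auto)
  have QA: "Q\<^sup>T * A' = four_block_mat ?e ?z ?z' (P\<^sup>T * A3)"
    unfolding QT A'b
    by (subst mult_four_block_mat[of _ 1 1 _ n _ n _ _ 1 _ n]) (use P A3 in auto)
  have QAQ: "Q\<^sup>T * A' * Q = four_block_mat ?e ?z ?z' D"
    unfolding QA unfolding Q_def
    by (subst mult_four_block_mat[of _ 1 1 _ n _ n _ _ 1 _ n]) (use P A3 PAP D in auto)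
  have "diagonal_mat (four_block_mat ?e ?z ?z' D)"
    using diag D unfolding diagonal_mat_def by auto
  moreover have "(W * Q)\<^sup>T * (W * Q) = 1\<^sub>m (Suc n)"
  proof -
    have "(W * Q)\<^sup>T * (W * Q) = Q\<^sup>T * (W\<^sup>T * W) * Q"
      using W Q WT by (simp add: transpose_mult[of _ "Suc n" "Suc n" _ "Suc n"] assoc_mult_mat[of _ "Suc n" "Suc n" _ "Suc n" _ "Suc n"])
    thus ?thesis using WW QQ Q by simp
  qed
  moreover have "(W * Q)\<^sup>T * A * (W * Q) = four_block_mat ?e ?z ?z' D"
  proof -
    have "(W * Q)\<^sup>T * A * (W * Q) = Q\<^sup>T * A' * Q"
      using W Q WT A unfolding A'_def
      by (simp add: transpose_mult[of _ "Suc n" "Suc n" _ "Suc n"] assoc_mult_mat[of _ "Suc n" "Suc n" _ "Suc n" _ "Suc n"])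
    thus ?thesis using QAQ by simp
  qed
  moreover have "W * Q \<in> carrier_mat (Suc n) (Suc n)" using W Q by simp
  moreover have "four_block_mat ?e ?z ?z' D \<in> carrier_mat (Suc n) (Suc n)" using D by auto
  ultimately show ?case by blast
qed

section \<open>Eigenvalues and quadratic forms\<close>

text \<open>
  The function \<open>d\<close> lists the eigenvalues with multiplicity, so that statements about all but one
  index also speak about multiplicities.
\<close>

definition orthogonally_diagonalizes :: "nat \<Rightarrow> real mat \<Rightarrow> (nat \<Rightarrow> real) \<Rightarrow> real mat \<Rightarrow> bool" where
  "orthogonally_diagonalizes n P d A \<longleftrightarrow> P \<in> carrier_mat n n \<and> A \<in> carrier_mat n n \<and>
     P\<^sup>T * P = 1\<^sub>m n \<and> P\<^sup>T * A * P = mat n n (\<lambda>(i, j). if i = j then d i else 0)"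

lemma real_symmetric_orthogonally_diagonalizes:
  assumes "A \<in> carrier_mat n n" and "A\<^sup>T = A"
  shows "\<exists>P d. orthogonally_diagonalizes n P d A"
proof -
  obtain P D where P: "P \<in> carrier_mat n n" "D \<in> carrier_mat n n" "P\<^sup>T * P = 1\<^sub>m n"
    "P\<^sup>T * A * P = D" "diagonal_mat D"
    using real_symmetric_orthogonally_diagonalizable[OF assms] by blast
  moreover have "D = mat n n (\<lambda>(i, j). if i = j then D $$ (i, i) else 0)"
    using P(2,5) by (intro eq_matI) (auto simp: diagonal_mat_def)
  ultimately have "orthogonally_diagonalizes n P (\<lambda>i. D $$ (i, i)) A"
    using assms unfolding orthogonally_diagonalizes_def by simp
  thus ?thesis by blast
qed

lemma orthogonally_diagonalizes_uminus:
  assumes "orthogonally_diagonalizes n P d A"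
  shows "orthogonally_diagonalizes n P (\<lambda>i. - d i) (- A)"
proof -
  have P: "P \<in> carrier_mat n n" and A: "A \<in> carrier_mat n n"
    and D: "P\<^sup>T * A * P = mat n n (\<lambda>(i, j). if i = j then d i else 0)"
    using assms unfolding orthogonally_diagonalizes_def by auto
  have "P\<^sup>T * (- A) * P = - (P\<^sup>T * A * P)"
    using P A by (subst uminus_mult_right_mat, simp, subst uminus_mult_left_mat) auto
  also have "\<dots> = mat n n (\<lambda>(i, j). if i = j then - d i else 0)"
    unfolding D by (rule eq_matI) auto
  finally show ?thesis using assms unfolding orthogonally_diagonalizes_def by auto
qed

lemma orthogonally_diagonalizes_quadratic_form:
  assumes P: "orthogonally_diagonalizes n P d A" and y: "y \<in> carrier_vec n"
  shows "(P *\<^sub>v y) \<bullet> (A *\<^sub>v (P *\<^sub>v y)) = (\<Sum>i<n. d i * (y $ i)\<^sup>2)"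
    and "(P *\<^sub>v y) \<bullet> (P *\<^sub>v y) = (\<Sum>i<n. (y $ i)\<^sup>2)"
proof -
  let ?D = "mat n n (\<lambda>(i, j). if i = j then d i else 0)"
  have P: "P \<in> carrier_mat n n" "P\<^sup>T \<in> carrier_mat n n" and A: "A \<in> carrier_mat n n"
    and PP: "P\<^sup>T * P = 1\<^sub>m n" and D: "P\<^sup>T * A * P = ?D"
    using P unfolding orthogonally_diagonalizes_def by auto
  have move: "(P *\<^sub>v y) \<bullet> z = y \<bullet> (P\<^sup>T *\<^sub>v z)" if "z \<in> carrier_vec n" for z
    using transpose_vec_mult_scalar[OF P(2) that y] by simp
  have "(P *\<^sub>v y) \<bullet> (A *\<^sub>v (P *\<^sub>v y)) = y \<bullet> (P\<^sup>T *\<^sub>v (A *\<^sub>v (P *\<^sub>v y)))"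
    using move P A y by simp
  also have "P\<^sup>T *\<^sub>v (A *\<^sub>v (P *\<^sub>v y)) = ?D *\<^sub>v y"
    using P A y unfolding D[symmetric] by (simp add: assoc_mult_mat_vec[of _ n n _ n])
  also have "?D *\<^sub>v y = vec n (\<lambda>i. d i * y $ i)"
    by (rule eq_vecI) (use y in \<open>auto simp: scalar_prod_def if_distrib[of "\<lambda>u. u * _"] cong: if_cong\<close>)
  also have "y \<bullet> vec n (\<lambda>i. d i * y $ i) = (\<Sum>i<n. d i * (y $ i)\<^sup>2)"
    by (auto simp: scalar_prod_def lessThan_atLeast0 power2_eq_square intro!: sum.cong)
  finally show "(P *\<^sub>v y) \<bullet> (A *\<^sub>v (P *\<^sub>v y)) = (\<Sum>i<n. d i * (y $ i)\<^sup>2)" .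
  have "(P *\<^sub>v y) \<bullet> (P *\<^sub>v y) = y \<bullet> ((P\<^sup>T * P) *\<^sub>v y)"
    using move P y by (simp add: assoc_mult_mat_vec[of _ n n _ n])
  also have "\<dots> = (\<Sum>i<n. (y $ i)\<^sup>2)"
    unfolding PP using y by (auto simp: scalar_prod_def lessThan_atLeast0 power2_eq_square)
  finally show "(P *\<^sub>v y) \<bullet> (P *\<^sub>v y) = (\<Sum>i<n. (y $ i)\<^sup>2)" .
qed

lemma orthogonally_diagonalizes_surj:
  assumes P: "orthogonally_diagonalizes n P d A" and x: "x \<in> carrier_vec n"
  shows "\<exists>y \<in> carrier_vec n. x = P *\<^sub>v y"
proof
  have P: "P \<in> carrier_mat n n" "P\<^sup>T \<in> carrier_mat n n" and PP: "P\<^sup>T * P = 1\<^sub>m n"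
    using P unfolding orthogonally_diagonalizes_def by auto
  have "P * P\<^sup>T = 1\<^sub>m n" using mat_mult_left_right_inverse[OF P(2,1) PP] .
  thus "x = P *\<^sub>v (P\<^sup>T *\<^sub>v x)"
    using P x by (metis assoc_mult_mat_vec one_mult_mat_vec)
  show "P\<^sup>T *\<^sub>v x \<in> carrier_vec n" using P x by simp
qed

lemma orthogonally_diagonalizes_char_poly:
  assumes P: "orthogonally_diagonalizes n P d A"
  shows "char_poly A = (\<Prod>i\<leftarrow>[0..<n]. [:- d i, 1:])"
proof -
  let ?D = "mat n n (\<lambda>(i, j). if i = j then d i else 0)"
  have P: "P \<in> carrier_mat n n" "P\<^sup>T \<in> carrier_mat n n" and A: "A \<in> carrier_mat n n"
    and PP: "P\<^sup>T * P = 1\<^sub>m n" and D: "P\<^sup>T * A * P = ?D"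
    using P unfolding orthogonally_diagonalizes_def by auto
  have "P * P\<^sup>T = 1\<^sub>m n" using mat_mult_left_right_inverse[OF P(2,1) PP] .
  hence "similar_mat_wit ?D A (P\<^sup>T) P"
    by (intro similar_mat_witI[of _ _ n]) (use P A PP D in auto)
  hence "char_poly ?D = char_poly A"
    using char_poly_similar unfolding similar_mat_def by blast
  moreover have "char_poly ?D = (\<Prod>a\<leftarrow>diag_mat ?D. [:- a, 1:])"
    by (rule char_poly_upper_triangular[of _ n]) auto
  moreover have "diag_mat ?D = map d [0..<n]"
    by (auto simp: diag_mat_def)
  ultimately show ?thesis by (simp add: comp_def)
qed

lemma orthogonally_diagonalizes_spectrum:
  assumes "orthogonally_diagonalizes n P d A"
  shows "spectrum A = d ` {..<n}"
proof -
  have A: "A \<in> carrier_mat n n" using assms unfolding orthogonally_diagonalizes_def by auto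
  show ?thesis
    unfolding spectrum_root_char_poly[OF A] orthogonally_diagonalizes_char_poly[OF assms]
    by (auto simp: poly_prod_list prod_list_zero_iff)
qed

lemma orthogonally_diagonalizes_order:
  assumes "orthogonally_diagonalizes n P d A"
  shows "Polynomial.order x (char_poly A) = card {i. i < n \<and> d i = x}"
proof -
  have "Polynomial.order x (char_poly A) = (\<Sum>i\<leftarrow>[0..<n]. if d i = x then 1 else 0)"
    unfolding orthogonally_diagonalizes_char_poly[OF assms]
    by (subst order_prod_list) (auto simp: comp_def order_linear' intro!: arg_cong[of _ _ sum_list])
  also have "\<dots> = (\<Sum>i\<in>{..<n}. if d i = x then 1 else 0)"
    by (simp add: interv_sum_list_conv_sum_set_nat lessThan_atLeast0)
  also have "\<dots> = card {i. i < n \<and> d i = x}"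
    by (simp add: sum.If_cases Int_def)
  finally show ?thesis .
qed

text \<open>
  The core is the Courant-Fischer bound on the second largest eigenvalue. The Rayleigh quotient at \<open>p\<close> forces some eigenvalue to be at least \<open>m\<close>, and no eigenvalue exceeds a
  bound \<open>M\<close> on all Rayleigh quotients. If a second eigenvalue, counted with multiplicity, exceeded
  \<open>\<epsilon>\<close>, then the quadratic form would exceed \<open>\<epsilon>\<close> times the squared norm on a plane; but every plane
  meets the hyperplane orthogonal to \<open>p\<close>, where the form is at most that.
\<close>

lemma one_eigenvalue_above_hyperplane_bound:
  assumes P: "orthogonally_diagonalizes n P d A"
    and p: "p \<in> carrier_vec n" "p \<bullet> p > 0" "p \<bullet> (A *\<^sub>v p) \<ge> m * (p \<bullet> p)"
    and perp: "\<And>x. x \<in> carrier_vec n \<Longrightarrow> x \<bullet> p = 0 \<Longrightarrow> x \<bullet> (A *\<^sub>v x) \<le> \<epsilon> * (x \<bullet> x)"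
    and up: "\<And>x. x \<in> carrier_vec n \<Longrightarrow> x \<bullet> (A *\<^sub>v x) \<le> M * (x \<bullet> x)"
    and \<epsilon>: "\<epsilon> < m"
  shows "\<exists>i<n. m \<le> d i \<and> d i \<le> M \<and> (\<forall>j<n. j \<noteq> i \<longrightarrow> d j \<le> \<epsilon>)"
proof -
  note form = orthogonally_diagonalizes_quadratic_form[OF P]
  have Pc: "P \<in> carrier_mat n n" and PP: "P\<^sup>T * P = 1\<^sub>m n"
    using P unfolding orthogonally_diagonalizes_def by auto
  obtain q where q: "q \<in> carrier_vec n" "p = P *\<^sub>v q"
    using orthogonally_diagonalizes_surj[OF P p(1)] by blast
  have qq: "p \<bullet> p = (\<Sum>i<n. (q $ i)\<^sup>2)" and qAq: "p \<bullet> (A *\<^sub>v p) = (\<Sum>i<n. d i * (q $ i)\<^sup>2)"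
    using form[OF q(1)] unfolding q(2) by auto
  \<comment> \<open>otherwise the form at \<open>p\<close>, an average of the \<open>d i\<close>, would be too small\<close>
  have "\<exists>i<n. m \<le> d i"
  proof (rule ccontr)
    assume "\<not> (\<exists>i<n. m \<le> d i)"
    hence less: "d i < m" if "i < n" for i using that by force
    have "(\<Sum>i<n. (m - d i) * (q $ i)\<^sup>2) \<le> 0"
      using p(3) unfolding qq qAq
      by (simp add: left_diff_distrib sum_subtractf sum_distrib_left)
    moreover have nonneg: "(m - d i) * (q $ i)\<^sup>2 \<ge> 0" if "i < n" for i
      using less[OF that] by simp
    ultimately have "(m - d i) * (q $ i)\<^sup>2 = 0" if "i < n" for i
      using that sum_nonneg_eq_0_iff[of "{..<n}" "\<lambda>i. (m - d i) * (q $ i)\<^sup>2"]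
        sum_nonneg[of "{..<n}" "\<lambda>i. (m - d i) * (q $ i)\<^sup>2"] by force
    hence "(q $ i)\<^sup>2 = 0" if "i < n" for i using less that by force
    thus False using p(2) unfolding qq by simp
  qed
  then obtain i where i: "i < n" "m \<le> d i" by blast
  have qP: "(P *\<^sub>v y) \<bullet> p = (\<Sum>k<n. y $ k * q $ k)" if y: "y \<in> carrier_vec n" for y
  proof -
    have "(P *\<^sub>v y) \<bullet> p = y \<bullet> (P\<^sup>T *\<^sub>v (P *\<^sub>v q))"
      unfolding q(2) using transpose_vec_mult_scalar[OF Pc y, of "P *\<^sub>v q"] Pc q y
      by (metis comm_scalar_prod mult_mat_vec_carrier transpose_carrier_mat)
    also have "P\<^sup>T *\<^sub>v (P *\<^sub>v q) = q"
      using assoc_mult_mat_vec[of "P\<^sup>T" n n P n q] Pc q PP by simp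
    finally show ?thesis using q by (simp add: scalar_prod_def lessThan_atLeast0)
  qed
  have "d i \<le> M"
    using up[of "P *\<^sub>v unit_vec n i"] form[of "unit_vec n i"] Pc i
    by (simp add: unit_vec_def if_distrib[of "\<lambda>u. u\<^sup>2"] if_distrib[of "\<lambda>u. _ * u"] cong: if_cong)
  moreover have "d j \<le> \<epsilon>" if j: "j < n" "j \<noteq> i" for j
  proof (rule ccontr)
    assume "\<not> d j \<le> \<epsilon>"
    \<comment> \<open>a nonzero vector orthogonal to \<open>p\<close> in the plane of the \<open>i\<close>-th and \<open>j\<close>-th eigenvectors\<close>
    obtain \<alpha> \<beta> where ab: "\<alpha> * q $ i + \<beta> * q $ j = 0" "\<alpha> \<noteq> 0 \<or> \<beta> \<noteq> 0"
    proof (cases "q $ i = 0")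
      case True thus ?thesis using that[of 1 0] by simp
    next
      case False thus ?thesis using that[of "q $ j" "- q $ i"] by simp
    qed
    define y where "y = vec n (\<lambda>k. if k = i then \<alpha> else if k = j then \<beta> else 0)"
    have y: "y \<in> carrier_vec n" by (simp add: y_def)
    have sum_y: "(\<Sum>k<n. f k (y $ k)) = f i \<alpha> + f j \<beta>" if "\<And>k. f k 0 = 0" for f :: "nat \<Rightarrow> real \<Rightarrow> real"
    proof -
      have "(\<Sum>k<n. f k (y $ k)) = (\<Sum>k\<in>{i, j}. f k (y $ k))"
        by (rule sum.mono_neutral_right) (use i j that in \<open>auto simp: y_def\<close>)
      thus ?thesis using i j by (simp add: y_def)
    qed
    have "(P *\<^sub>v y) \<bullet> p = 0" using ab sum_y[of "\<lambda>k u. u * q $ k"] by (simp add: qP[OF y])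
    hence "d i * \<alpha>\<^sup>2 + d j * \<beta>\<^sup>2 \<le> \<epsilon> * (\<alpha>\<^sup>2 + \<beta>\<^sup>2)"
      using perp[of "P *\<^sub>v y"] Pc y sum_y[of "\<lambda>k u. d k * u\<^sup>2"] sum_y[of "\<lambda>k u. u\<^sup>2"]
      by (simp add: form[OF y])
    hence le: "(d i - \<epsilon>) * \<alpha>\<^sup>2 + (d j - \<epsilon>) * \<beta>\<^sup>2 \<le> 0" by (simp add: algebra_simps)
    have pos: "d i - \<epsilon> > 0" "d j - \<epsilon> > 0" using i \<epsilon> \<open>\<not> d j \<le> \<epsilon>\<close> by auto
    have "(d i - \<epsilon>) * \<alpha>\<^sup>2 \<ge> 0" "(d j - \<epsilon>) * \<beta>\<^sup>2 \<ge> 0" using pos by auto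
    with le have "(d i - \<epsilon>) * \<alpha>\<^sup>2 = 0" "(d j - \<epsilon>) * \<beta>\<^sup>2 = 0" by linarith+
    thus False using pos ab by simp
  qed
  ultimately show ?thesis using i by blast
qed

section \<open>Matrices close to a star\<close>

text \<open>
  The entries outside the row and the column of the centre \<open>c\<close> form a symmetric nonnegative matrix
  with row sums at most \<open>K\<close>, and such a matrix has norm at most \<open>K\<close>: this is Schur's test, here
  by \<open>2 |x\<^sub>i x\<^sub>j| \<le> x\<^sub>i\<^sup>2 + x\<^sub>j\<^sup>2\<close>.
\<close>

lemma quadratic_form_star_error:
  fixes a :: "nat \<Rightarrow> nat \<Rightarrow> real" and x :: "nat \<Rightarrow> real"
  assumes I: "finite I" "c \<in> I"
    and sym: "\<And>i j. a i j = a j i" and nonneg: "\<And>i j. a i j \<ge> 0" and loop: "a c c = 0"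
    and deg: "\<And>i. i \<in> I \<Longrightarrow> i \<noteq> c \<Longrightarrow> (\<Sum>j\<in>I - {c}. a i j) \<le> K" and K: "K \<ge> 0"
  shows "\<bar>(\<Sum>i\<in>I. \<Sum>j\<in>I. a i j * (x i * x j)) - 2 * x c * (\<Sum>j\<in>I. a c j * x j)\<bar>
           \<le> K * (\<Sum>i\<in>I. (x i)\<^sup>2)"
proof -
  let ?J = "I - {c}"
  define R where "R = (\<Sum>j\<in>?J. a c j * x j)"
  define E where "E = (\<Sum>i\<in>?J. \<Sum>j\<in>?J. a i j * (x i * x j))"
  have fin: "finite ?J" using I by simp
  have row: "(\<Sum>j\<in>I. a i j * (x i * x j)) = a i c * (x i * x c) + (\<Sum>j\<in>?J. a i j * (x i * x j))" for i
    using I by (simp add: sum.remove[of I c])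
  have "(\<Sum>i\<in>I. \<Sum>j\<in>I. a i j * (x i * x j))
      = (\<Sum>j\<in>I. a c j * (x c * x j)) + (\<Sum>i\<in>?J. \<Sum>j\<in>I. a i j * (x i * x j))"
    by (rule sum.remove[OF I])
  also have "\<dots> = (\<Sum>j\<in>?J. a c j * (x c * x j)) + ((\<Sum>i\<in>?J. a i c * (x i * x c)) + E)"
    by (simp only: row loop E_def sum.distrib)
  finally have "(\<Sum>i\<in>I. \<Sum>j\<in>I. a i j * (x i * x j))
      = (\<Sum>j\<in>?J. a c j * (x c * x j)) + ((\<Sum>i\<in>?J. a i c * (x i * x c)) + E)" .
  moreover have "(\<Sum>j\<in>?J. a c j * (x c * x j)) = x c * R"
    unfolding R_def sum_distrib_left by (simp add: algebra_simps)
  moreover have "(\<Sum>i\<in>?J. a i c * (x i * x c)) = x c * R"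
    unfolding R_def sum_distrib_left by (rule sum.cong) (simp_all add: sym[of _ c])
  moreover have "(\<Sum>j\<in>I. a c j * x j) = R"
    unfolding R_def by (simp add: sum.remove[OF I, of "\<lambda>j. a c j * x j"] loop)
  ultimately have eq: "(\<Sum>i\<in>I. \<Sum>j\<in>I. a i j * (x i * x j)) - 2 * x c * (\<Sum>j\<in>I. a c j * x j) = E"
    by simp
  have amgm: "\<bar>x i * x j\<bar> \<le> ((x i)\<^sup>2 + (x j)\<^sup>2) / 2" for i j
  proof -
    have "0 \<le> (\<bar>x i\<bar> - \<bar>x j\<bar>)\<^sup>2" by simp
    thus ?thesis by (simp add: power2_diff abs_mult)
  qed
  have "\<bar>E\<bar> \<le> (\<Sum>i\<in>?J. \<Sum>j\<in>?J. a i j * (((x i)\<^sup>2 + (x j)\<^sup>2) / 2))"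
    unfolding E_def
  proof (intro order.trans[OF sum_abs] sum_mono)
    fix i j
    show "\<bar>a i j * (x i * x j)\<bar> \<le> a i j * (((x i)\<^sup>2 + (x j)\<^sup>2) / 2)"
      using mult_left_mono[OF amgm nonneg] by (simp only: abs_mult[of "a i j"] abs_of_nonneg[OF nonneg])
  qed
  also have "\<dots> = (\<Sum>i\<in>?J. \<Sum>j\<in>?J. a i j * ((x i)\<^sup>2 / 2)) + (\<Sum>i\<in>?J. \<Sum>j\<in>?J. a i j * ((x j)\<^sup>2 / 2))"
    by (simp add: sum.distrib add_divide_distrib distrib_left)
  also have "(\<Sum>i\<in>?J. \<Sum>j\<in>?J. a i j * ((x j)\<^sup>2 / 2)) = (\<Sum>i\<in>?J. \<Sum>j\<in>?J. a i j * ((x i)\<^sup>2 / 2))"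
    by (subst sum.swap) (simp add: sym)
  also have "(\<Sum>i\<in>?J. \<Sum>j\<in>?J. a i j * ((x i)\<^sup>2 / 2)) + (\<Sum>i\<in>?J. \<Sum>j\<in>?J. a i j * ((x i)\<^sup>2 / 2))
      = (\<Sum>i\<in>?J. (\<Sum>j\<in>?J. a i j) * (x i)\<^sup>2)"
    by (simp add: sum.distrib[symmetric] sum_distrib_right flip: distrib_left)
  also have "\<dots> \<le> (\<Sum>i\<in>?J. K * (x i)\<^sup>2)"
    by (intro sum_mono mult_right_mono deg) auto
  also have "\<dots> \<le> (\<Sum>i\<in>I. K * (x i)\<^sup>2)"
    by (intro sum_mono2) (use I K in auto)
  finally show ?thesis unfolding eq by (simp add: sum_distrib_left)
qed

text \<open>
  The left-hand side is the form of a normalized star with centre \<open>c\<close>, so the bound says that the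
  star has norm at most one: Cauchy-Schwarz on the leaves, followed by \<open>2 |u t| \<le> u\<^sup>2 + t\<^sup>2\<close>.
\<close>

lemma star_form_le:
  fixes g x :: "nat \<Rightarrow> real"
  assumes I: "finite I" "c \<in> I" and unit: "(\<Sum>j\<in>I. (g j)\<^sup>2) = 1" and g: "g c = 0"
  shows "2 * \<bar>x c * (\<Sum>j\<in>I. g j * x j)\<bar> \<le> (\<Sum>j\<in>I. (x j)\<^sup>2)"
proof -
  let ?J = "I - {c}"
  define t where "t = (\<Sum>j\<in>I. g j * x j)"
  have t: "(\<Sum>j\<in>?J. g j * x j) = t" and u: "(\<Sum>j\<in>?J. (g j)\<^sup>2) = 1"
    unfolding t_def using unit I g by (simp_all add: sum.remove[OF I])
  have "0 \<le> (\<Sum>j\<in>?J. (x j - t * g j)\<^sup>2)" by (intro sum_nonneg) simp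
  also have "\<dots> = (\<Sum>j\<in>?J. (x j)\<^sup>2) - 2 * t * (\<Sum>j\<in>?J. g j * x j) + t\<^sup>2 * (\<Sum>j\<in>?J. (g j)\<^sup>2)"
    by (simp add: power2_diff power_mult_distrib sum.distrib sum_subtractf sum_distrib_left algebra_simps)
  finally have "t\<^sup>2 \<le> (\<Sum>j\<in>?J. (x j)\<^sup>2)" unfolding t u by (simp add: power2_eq_square)
  moreover have "0 \<le> (\<bar>x c\<bar> - \<bar>t\<bar>)\<^sup>2" by simp
  ultimately have "2 * \<bar>x c * t\<bar> \<le> (x c)\<^sup>2 + (\<Sum>j\<in>?J. (x j)\<^sup>2)"
    by (simp add: power2_diff abs_mult)
  thus ?thesis using I by (simp add: sum.remove[OF I] t_def)
qed

text \<open>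
  The star with centre \<open>c\<close> and normalized leaf vector \<open>g\<close> has rank two, with eigenvectors
  \<open>g + e\<^sub>c\<close> and \<open>g - e\<^sub>c\<close> for the eigenvalues \<open>1\<close> and \<open>-1\<close>. Its form is \<open>2 x\<^sub>c (g \<bullet> x)\<close>, which is
  \<open>-2 x\<^sub>c\<^sup>2\<close> on the hyperplane orthogonal to \<open>g + e\<^sub>c\<close> and \<open>2 x\<^sub>c\<^sup>2\<close> on the one orthogonal to
  \<open>g - e\<^sub>c\<close>. Since \<open>B\<close> differs from the star by a form of norm at most \<open>\<epsilon>\<close>, the lemma
  \<open>one_eigenvalue_above_hyperplane_bound\<close> applies to \<open>B\<close> with the first vector and to \<open>- B\<close> with
  the second.
\<close>

lemma near_star_matrix_spectrum:
  fixes a :: "nat \<Rightarrow> nat \<Rightarrow> real"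
  assumes c: "c < n" and sym: "\<And>i j. a i j = a j i" and a01: "\<And>i j. a i j \<in> {0, 1}"
    and loop: "a c c = 0" and k: "(\<Sum>j<n. a c j) = k" "k > 0"
    and deg: "\<And>i. i < n \<Longrightarrow> i \<noteq> c \<Longrightarrow> (\<Sum>j<n. a i j) \<le> K" and K: "K \<ge> 0"
    and small: "2 * (K / sqrt k) < 1"
  defines "\<epsilon> \<equiv> K / sqrt k" and "B \<equiv> mat n n (\<lambda>(i, j). a i j / sqrt k)"
  shows "\<exists>P d. orthogonally_diagonalizes n P d B \<and>
     (\<exists>p<n. \<exists>q<n. \<bar>d p - 1\<bar> \<le> \<epsilon> \<and> \<bar>d q + 1\<bar> \<le> \<epsilon> \<and> (\<forall>j<n. j \<noteq> p \<longrightarrow> j \<noteq> q \<longrightarrow> \<bar>d j\<bar> \<le> \<epsilon>))"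
proof -
  have B: "B \<in> carrier_mat n n" by (simp add: B_def)
  have "B\<^sup>T = B" by (rule eq_matI) (auto simp: B_def sym)
  then obtain P d where P: "orthogonally_diagonalizes n P d B"
    using real_symmetric_orthogonally_diagonalizes[OF B] by blast
  have nonneg: "a i j \<ge> 0" for i j using a01[of i j] by auto
  have I: "finite {..<n}" "c \<in> {..<n}" using c by auto
  have \<epsilon>0: "\<epsilon> \<ge> 0" using K k by (simp add: \<epsilon>_def)
  define g where "g j = a c j / sqrt k" for j
  have gc: "g c = 0" by (simp add: g_def loop)
  have g1: "(\<Sum>j<n. (g j)\<^sup>2) = 1"
  proof -
    have "(g j)\<^sup>2 = a c j / k" for j using a01[of c j] k by (auto simp: g_def power_divide)
    thus ?thesis using k by (simp add: sum_divide_distrib[symmetric])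
  qed
  have sq: "x \<bullet> x = (\<Sum>j<n. (x $ j)\<^sup>2)" if "x \<in> carrier_vec n" for x :: "real vec"
    using that by (simp add: scalar_prod_def lessThan_atLeast0 power2_eq_square)
  have err: "\<bar>x \<bullet> (B *\<^sub>v x) - 2 * (x $ c * (\<Sum>j<n. g j * x $ j))\<bar> \<le> \<epsilon> * (x \<bullet> x)"
    if x: "x \<in> carrier_vec n" for x
  proof -
    have "x \<bullet> (B *\<^sub>v x) = (\<Sum>i<n. \<Sum>j<n. a i j * (x $ i * x $ j)) / sqrt k"
      using x B by (simp add: scalar_prod_def lessThan_atLeast0 B_def sum_distrib_left
          sum_divide_distrib algebra_simps)
    moreover have "(\<Sum>j<n. g j * x $ j) = (\<Sum>j<n. a c j * x $ j) / sqrt k"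
      by (simp add: g_def sum_divide_distrib)
    ultimately have "x \<bullet> (B *\<^sub>v x) - 2 * (x $ c * (\<Sum>j<n. g j * x $ j))
      = ((\<Sum>i<n. \<Sum>j<n. a i j * (x $ i * x $ j)) - 2 * x $ c * (\<Sum>j<n. a c j * x $ j)) / sqrt k"
      by (simp add: diff_divide_distrib)
    moreover have "\<bar>(\<Sum>i<n. \<Sum>j<n. a i j * (x $ i * x $ j)) - 2 * x $ c * (\<Sum>j<n. a c j * x $ j)\<bar>
       \<le> K * (\<Sum>i<n. (x $ i)\<^sup>2)"
    proof (rule quadratic_form_star_error[where a = a and I = "{..<n}"])
      fix i assume "i \<in> {..<n}" "i \<noteq> c"
      hence "(\<Sum>j<n. a i j) \<le> K" using deg by simp
      moreover have "(\<Sum>j\<in>{..<n} - {c}. a i j) \<le> (\<Sum>j<n. a i j)"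
        by (intro sum_mono2) (auto simp: nonneg)
      ultimately show "(\<Sum>j\<in>{..<n} - {c}. a i j) \<le> K" by simp
    qed (use I sym nonneg loop K in auto)
    ultimately show ?thesis
      using k by (simp add: sq[OF x] \<epsilon>_def divide_right_mono)
  qed
  have up: "\<bar>x \<bullet> (B *\<^sub>v x)\<bar> \<le> (1 + \<epsilon>) * (x \<bullet> x)" if x: "x \<in> carrier_vec n" for x
    using err[OF x] star_form_le[OF I g1 gc, of "\<lambda>j. x $ j"]
    unfolding sq[OF x] distrib_right by linarith
  have sum_c: "(\<Sum>j<n. (if j = c then u else f j)) = u + (\<Sum>j<n. f j)" if "f c = 0" for u and f :: "nat \<Rightarrow> real"
    using that by (simp add: sum.remove[OF I])
  \<comment> \<open>\<open>p 1\<close> and \<open>p (-1)\<close> are the two eigenvectors of the star\<close>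
  define p where "p s = vec n (\<lambda>j. if j = c then s else g j)" for s :: real
  have p: "p s \<in> carrier_vec n" for s by (simp add: p_def)
  have pp: "p s \<bullet> p s = s\<^sup>2 + 1" for s
    unfolding sq[OF p] using sum_c[of "\<lambda>j. (g j)\<^sup>2" "s\<^sup>2"] gc g1
    by (simp add: p_def if_distrib[of "\<lambda>u. u\<^sup>2"] cong: if_cong)
  have gp: "(\<Sum>j<n. g j * p s $ j) = 1" and pc: "p s $ c = s" for s
  proof -
    have "(\<Sum>j<n. g j * p s $ j) = (\<Sum>j<n. (g j)\<^sup>2)"
      by (rule sum.cong) (auto simp: p_def gc power2_eq_square)
    thus "(\<Sum>j<n. g j * p s $ j) = 1" using g1 by simp
    show "p s $ c = s" using c by (simp add: p_def)
  qed
  have xp: "x \<bullet> p s = s * x $ c + (\<Sum>j<n. g j * x $ j)" if x: "x \<in> carrier_vec n" for x s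
  proof -
    have "x \<bullet> p s = (\<Sum>j<n. if j = c then s * x $ c else g j * x $ j)"
      unfolding scalar_prod_def using x
      by (auto simp: p_def lessThan_atLeast0 intro!: sum.cong)
    thus ?thesis using sum_c[of "\<lambda>j. g j * x $ j"] gc by simp
  qed
  have neg: "x \<bullet> (- B *\<^sub>v x) = - (x \<bullet> (B *\<^sub>v x))" if x: "x \<in> carrier_vec n" for x
    using x B by (simp add: uminus_mult_mat_vec)
  have star: "s * (2 * (x $ c * (\<Sum>j<n. g j * x $ j))) \<le> 0"
    if x: "x \<in> carrier_vec n" and perp: "x \<bullet> p s = 0" and s: "s\<^sup>2 = 1" for x s
  proof -
    have "(\<Sum>j<n. g j * x $ j) = - s * x $ c" using xp[OF x, of s] perp by simp
    hence eq: "s * (2 * (x $ c * (\<Sum>j<n. g j * x $ j))) = - 2 * (s\<^sup>2 * (x $ c)\<^sup>2)"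
      by (simp add: power2_eq_square)
    show ?thesis unfolding eq s by simp
  qed
  have "\<exists>i<n. 1 - \<epsilon> \<le> d i \<and> d i \<le> 1 + \<epsilon> \<and> (\<forall>j<n. j \<noteq> i \<longrightarrow> d j \<le> \<epsilon>)"
  proof (rule one_eigenvalue_above_hyperplane_bound[OF P p[of 1]])
    show "p 1 \<bullet> p 1 > 0" by (simp add: pp)
    show "(1 - \<epsilon>) * (p 1 \<bullet> p 1) \<le> p 1 \<bullet> (B *\<^sub>v p 1)"
      using err[OF p[of 1]] by (simp add: pp gp pc algebra_simps)
    show "\<epsilon> < 1 - \<epsilon>" using small by (simp add: \<epsilon>_def)
  next
    fix x :: "real vec" assume x: "x \<in> carrier_vec n"
    show "x \<bullet> (B *\<^sub>v x) \<le> (1 + \<epsilon>) * (x \<bullet> x)" using up[OF x] by simp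
    assume "x \<bullet> p 1 = 0"
    thus "x \<bullet> (B *\<^sub>v x) \<le> \<epsilon> * (x \<bullet> x)" using star[OF x, of 1] err[OF x] by simp
  qed
  then obtain i where i: "i < n" "1 - \<epsilon> \<le> d i" "d i \<le> 1 + \<epsilon>" "\<And>j. j < n \<Longrightarrow> j \<noteq> i \<Longrightarrow> d j \<le> \<epsilon>"
    by blast
  have "\<exists>i<n. 1 - \<epsilon> \<le> - d i \<and> - d i \<le> 1 + \<epsilon> \<and> (\<forall>j<n. j \<noteq> i \<longrightarrow> - d j \<le> \<epsilon>)"
  proof (rule one_eigenvalue_above_hyperplane_bound[OF orthogonally_diagonalizes_uminus[OF P] p[of "-1"]])
    show "p (-1) \<bullet> p (-1) > 0" by (simp add: pp)
    show "(1 - \<epsilon>) * (p (-1) \<bullet> p (-1)) \<le> p (-1) \<bullet> (- B *\<^sub>v p (-1))"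
      using err[OF p[of "-1"]] by (simp add: neg[OF p] pp gp pc algebra_simps)
    show "\<epsilon> < 1 - \<epsilon>" using small by (simp add: \<epsilon>_def)
  next
    fix x :: "real vec" assume x: "x \<in> carrier_vec n"
    show "x \<bullet> (- B *\<^sub>v x) \<le> (1 + \<epsilon>) * (x \<bullet> x)" using up[OF x] by (simp add: neg[OF x])
    assume "x \<bullet> p (-1) = 0"
    thus "x \<bullet> (- B *\<^sub>v x) \<le> \<epsilon> * (x \<bullet> x)"
      using star[OF x, of "-1"] err[OF x] by (simp add: neg[OF x])
  qed
  then obtain j where j: "j < n" "1 - \<epsilon> \<le> - d j" "- d j \<le> 1 + \<epsilon>" "\<And>l. l < n \<Longrightarrow> l \<noteq> j \<Longrightarrow> - d l \<le> \<epsilon>"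
    by blast
  have "\<bar>d i - 1\<bar> \<le> \<epsilon>" "\<bar>d j + 1\<bar> \<le> \<epsilon>" using i j by auto
  moreover have "\<bar>d l\<bar> \<le> \<epsilon>" if "l < n" "l \<noteq> i" "l \<noteq> j" for l
    using i(4)[OF that(1,2)] j(4)[OF that(1,3)] by simp
  ultimately show ?thesis using P i(1) j(1) by blast
qed

section \<open>Neighbourhoods in iterated star products\<close>

lemma snd_star_power: "snd (star_power (G, r) N) = replicate N r"
  by (induction N) (auto simp: relabel_def star_product_def case_prod_unfold)

lemma pverts_star_power_Suc:
  "pverts (fst (star_power (G, r) (Suc N))) =
     (\<lambda>x. x # replicate N r) ` pverts G \<union> (#) r ` pverts (fst (star_power (G, r) N))"
  using snd_star_power[of G r N]
  by (auto simp: relabel_def star_product_def split: prod.splits)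

lemma parcs_star_power_Suc:
  "(u, v) \<in> parcs (fst (star_power (G, r) (Suc N))) \<longleftrightarrow>
     (\<exists>x y. (x, y) \<in> parcs G \<and> u = x # replicate N r \<and> v = y # replicate N r) \<or>
     (\<exists>xs ys. (xs, ys) \<in> parcs (fst (star_power (G, r) N)) \<and> u = r # xs \<and> v = r # ys)"
  using snd_star_power[of G r N]
  by (auto simp: relabel_def star_product_def image_iff split: prod.splits)

lemma root_in_star_power:
  assumes "r \<in> pverts G"
  shows "replicate N r \<in> pverts (fst (star_power (G, r) N))"
  using assms by (induction N) (auto simp: pverts_star_power_Suc simp del: star_power.simps(2))

context pair_graph
begin

lemma no_loop: "(x, x) \<notin> parcs G"
  using pair_no_loops[of "(x, x)"] by auto

lemma arc_sym: "(x, y) \<in> parcs G \<Longrightarrow> (y, x) \<in> parcs G"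
  using pair_sym_arcs by (auto simp: symmetric_def sym_def)

lemma finite_out_neighbours: "finite (parcs G `` {x})"
  by (rule finite_subset[OF _ pair_finite_verts]) (auto dest: in_arcsD2)

lemma star_power_arcs_in_verts:
  "(u, v) \<in> parcs (fst (star_power (G, r) N)) \<Longrightarrow> v \<in> pverts (fst (star_power (G, r) N))"
proof (induction N arbitrary: u v)
  case (Suc N)
  thus ?case unfolding parcs_star_power_Suc pverts_star_power_Suc by (blast dest: in_arcsD2)
qed simp

lemma star_power_arc_sym:
  "(u, v) \<in> parcs (fst (star_power (G, r) N)) \<Longrightarrow> (v, u) \<in> parcs (fst (star_power (G, r) N))"
proof (induction N arbitrary: u v)
  case (Suc N)
  thus ?case unfolding parcs_star_power_Suc by (blast dest: arc_sym)
qed simp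

lemma star_power_no_loop: "(u, u) \<notin> parcs (fst (star_power (G, r) N))"
proof (induction N arbitrary: u)
  case (Suc N)
  thus ?case unfolding parcs_star_power_Suc using no_loop by auto
qed simp

text \<open>
  Each of the \<open>N\<close> copies contributes the neighbours of its root, and distinct copies share only the
  root.
\<close>

lemma star_power_root_neighbours:
  "finite (parcs (fst (star_power (G, r) N)) `` {replicate N r}) \<and>
   card (parcs (fst (star_power (G, r) N)) `` {replicate N r}) = card (parcs G `` {r}) * N"
proof (induction N)
  case (Suc N)
  let ?f = "\<lambda>y. y # replicate N r"
  let ?S = "parcs (fst (star_power (G, r) N)) `` {replicate N r}"
  have eq: "parcs (fst (star_power (G, r) (Suc N))) `` {replicate (Suc N) r}
      = ?f ` (parcs G `` {r}) \<union> (#) r ` ?S"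
    by (auto simp: parcs_star_power_Suc simp del: star_power.simps(2))
  have "?f ` (parcs G `` {r}) \<inter> (#) r ` ?S = {}"
    using no_loop[of r] by auto
  moreover have "inj_on ?f A" for A by (auto simp: inj_on_def)
  ultimately show ?case
    unfolding eq using Suc finite_out_neighbours[of r]
    by (simp add: card_Un_disjoint card_image)
qed simp

text \<open>
  A vertex other than the root lies in a single copy, so its degree is bounded independently of
  \<open>N\<close>. If its first entry is \<open>r\<close>, it lies in one of the last \<open>N - 1\<close> copies; otherwise it lies in
  the first one.
\<close>

lemma star_power_other_degree_le:
  assumes "u \<noteq> replicate N r"
  shows "card (parcs (fst (star_power (G, r) N)) `` {u}) \<le> card (pverts G)"
  using assms
proof (induction N arbitrary: u)
  case (Suc N)
  show ?case
  proof (cases "\<exists>xs. u = r # xs")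
    case True
    then obtain xs where u: "u = r # xs" by blast
    hence xs: "xs \<noteq> replicate N r" using Suc.prems by auto
    hence "parcs (fst (star_power (G, r) (Suc N))) `` {u}
        = (#) r ` (parcs (fst (star_power (G, r) N)) `` {xs})"
      unfolding u by (auto simp: parcs_star_power_Suc simp del: star_power.simps(2))
    thus ?thesis using Suc.IH[OF xs] by (simp add: card_image del: star_power.simps(2))
  next
    case False
    hence "parcs (fst (star_power (G, r) (Suc N))) `` {u} \<subseteq> (\<lambda>y. y # replicate N r) ` pverts G"
      by (auto simp: parcs_star_power_Suc simp del: star_power.simps(2) intro!: imageI in_arcsD2)
    thus ?thesis using pair_finite_verts by (meson surj_card_le)
  qed
qed simp

end

section \<open>The spectrum of iterated star products\<close>

text \<open>
  Since \<open>\<epsilon> < 1 - \<epsilon>\<close>, the intervals of radius \<open>\<epsilon>\<close> around \<open>-1\<close>, \<open>0\<close> and \<open>1\<close> are disjoint, so the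
  eigenvalues near \<open>1\<close> and \<open>-1\<close> are the unique extreme ones.
\<close>

lemma extreme_eigenvalues_isolated:
  fixes B :: "real mat"
  assumes P: "orthogonally_diagonalizes n P d B" and pq: "p < n" "q < n"
    and p: "\<bar>d p - 1\<bar> \<le> \<epsilon>" and q: "\<bar>d q + 1\<bar> \<le> \<epsilon>"
    and rest: "\<And>j. j < n \<Longrightarrow> j \<noteq> p \<Longrightarrow> j \<noteq> q \<Longrightarrow> \<bar>d j\<bar> \<le> \<epsilon>" and \<epsilon>: "2 * \<epsilon> < 1"
  defines "l \<equiv> Max (spectrum B)" and "m \<equiv> Min (spectrum B)"
  shows "Polynomial.order l (char_poly B) = 1" "Polynomial.order m (char_poly B) = 1"
    and "\<bar>l - 1\<bar> \<le> \<epsilon>" "\<bar>m + 1\<bar> \<le> \<epsilon>" "\<And>x. x \<in> spectrum B - {l, m} \<Longrightarrow> \<bar>x\<bar> \<le> \<epsilon>"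
proof -
  have spec: "spectrum B = d ` {..<n}" using orthogonally_diagonalizes_spectrum[OF P] .
  have dp: "d j < d p" if "j < n" "j \<noteq> p" for j
    using rest[of j] p q \<epsilon> that by (cases "j = q") auto
  have dq: "d q < d j" if "j < n" "j \<noteq> q" for j
    using rest[of j] p q \<epsilon> that by (cases "j = p") auto
  have l: "l = d p" unfolding l_def spec
    by (rule Max_eqI) (use pq dp in \<open>auto simp: le_less\<close>)
  have m: "m = d q" unfolding m_def spec
    by (rule Min_eqI) (use pq dq in \<open>auto simp: le_less\<close>)
  have "{i. i < n \<and> d i = l} = {p}" unfolding l using pq dp by force
  thus "Polynomial.order l (char_poly B) = 1"
    by (simp add: orthogonally_diagonalizes_order[OF P])
  have "{i. i < n \<and> d i = m} = {q}" unfolding m using pq dq by force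
  thus "Polynomial.order m (char_poly B) = 1"
    by (simp add: orthogonally_diagonalizes_order[OF P])
  show "\<bar>l - 1\<bar> \<le> \<epsilon>" "\<bar>m + 1\<bar> \<le> \<epsilon>" using p q l m by simp_all
  show "\<bar>x\<bar> \<le> \<epsilon>" if "x \<in> spectrum B - {l, m}" for x
    using that rest unfolding spec l m by auto
qed

lemma sum_indicator_eq_card_neighbours:
  assumes "distinct xs" and "E `` {u} \<subseteq> set xs"
  shows "(\<Sum>j<length xs. if (u, xs ! j) \<in> E then 1 else 0) = real (card (E `` {u}))"
proof -
  have "(\<Sum>j<length xs. if (u, xs ! j) \<in> E then 1 else 0) = real (card {j. j < length xs \<and> (u, xs ! j) \<in> E})"
    by (simp add: sum.If_cases Int_def)
  moreover have "(!) xs ` {j. j < length xs \<and> (u, xs ! j) \<in> E} = E `` {u}"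
    using assms(2) by (auto simp: in_set_conv_nth image_iff subset_iff)
  moreover have "inj_on ((!) xs) {j. j < length xs \<and> (u, xs ! j) \<in> E}"
    using assms(1) by (auto simp: inj_on_def nth_eq_iff_index_eq)
  ultimately show ?thesis
    using card_image[of "(!) xs" "{j. j < length xs \<and> (u, xs ! j) \<in> E}"] by simp
qed

text \<open>
  The quantitative form of the result: for every \<open>N\<close> with \<open>\<epsilon> < 1/2\<close> the spectrum is within
  \<open>\<epsilon> = |V| / sqrt (deg(o) N)\<close> of that of the normalized star.
\<close>

lemma (in pair_graph) normalized_star_power_spectrum:
  assumes r: "r \<in> pverts G" and vs: "distinct vs" "set vs = pverts (fst (star_power (G, r) N))"
    and deg: "card (parcs G `` {r}) \<ge> 1" and N: "N \<ge> 1"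
  defines "k \<equiv> real (card (parcs G `` {r}) * N)"
  defines "\<epsilon> \<equiv> card (pverts G) / sqrt k"
    and "B \<equiv> (k powr (- 1 / 2)) \<cdot>\<^sub>m adjacency_matrix (fst (star_power (G, r) N)) vs"
  defines "l \<equiv> Max (spectrum B)" and "m \<equiv> Min (spectrum B)"
  assumes small: "2 * \<epsilon> < 1"
  shows "Polynomial.order l (char_poly B) = 1" "Polynomial.order m (char_poly B) = 1"
    and "\<bar>l - 1\<bar> \<le> \<epsilon>" "\<bar>m + 1\<bar> \<le> \<epsilon>" "\<And>x. x \<in> spectrum B - {l, m} \<Longrightarrow> \<bar>x\<bar> \<le> \<epsilon>"
proof -
  let ?E = "parcs (fst (star_power (G, r) N))"
  define a :: "nat \<Rightarrow> nat \<Rightarrow> real" where "a i j = (if (vs ! i, vs ! j) \<in> ?E then 1 else 0)" for i j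
  have k: "k > 0" using deg N by (simp add: k_def)
  obtain c where c: "c < length vs" "vs ! c = replicate N r"
    using root_in_star_power[OF r] vs(2) by (metis in_set_conv_nth)
  have row: "(\<Sum>j<length vs. a i j) = real (card (?E `` {vs ! i}))" for i
    unfolding a_def
    by (rule sum_indicator_eq_card_neighbours) (use vs star_power_arcs_in_verts in auto)
  have B: "B = mat (length vs) (length vs) (\<lambda>(i, j). a i j / sqrt k)"
  proof (rule eq_matI)
    have "k powr (- 1 / 2) = 1 / sqrt k"
      using k powr_minus_divide[of k "1 / 2"] by (simp add: powr_half_sqrt)
    thus "B $$ (i, j) = mat (length vs) (length vs) (\<lambda>(i, j). a i j / sqrt k) $$ (i, j)"
      if "i < dim_row (mat (length vs) (length vs) (\<lambda>(i, j). a i j / sqrt k))"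
         "j < dim_col (mat (length vs) (length vs) (\<lambda>(i, j). a i j / sqrt k))" for i j
      using that by (simp add: B_def adjacency_matrix_def a_def)
  qed (simp_all add: B_def adjacency_matrix_def)
  have "\<exists>P d. orthogonally_diagonalizes (length vs) P d (mat (length vs) (length vs) (\<lambda>(i, j). a i j / sqrt k)) \<and>
     (\<exists>p<length vs. \<exists>q<length vs. \<bar>d p - 1\<bar> \<le> \<epsilon> \<and> \<bar>d q + 1\<bar> \<le> \<epsilon> \<and>
        (\<forall>j<length vs. j \<noteq> p \<longrightarrow> j \<noteq> q \<longrightarrow> \<bar>d j\<bar> \<le> \<epsilon>))"
    unfolding \<epsilon>_def
  proof (rule near_star_matrix_spectrum[OF c(1)])
    show "a i j = a j i" "a i j \<in> {0, 1}" for i j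
      using star_power_arc_sym by (auto simp: a_def)
    show "a c c = 0" by (simp add: a_def star_power_no_loop)
    show "(\<Sum>j<length vs. a c j) = k"
      unfolding row c(2) k_def using star_power_root_neighbours by simp
    show "(\<Sum>j<length vs. a i j) \<le> card (pverts G)" if "i < length vs" "i \<noteq> c" for i
    proof -
      have "vs ! i \<noteq> replicate N r" using that c vs(1) by (metis nth_eq_iff_index_eq)
      thus ?thesis unfolding row using star_power_other_degree_le by simp
    qed
  qed (use k small in \<open>simp_all add: \<epsilon>_def\<close>)
  then obtain P d p q where P: "orthogonally_diagonalizes (length vs) P d B" and
    pq: "p < length vs" "q < length vs" "\<bar>d p - 1\<bar> \<le> \<epsilon>" "\<bar>d q + 1\<bar> \<le> \<epsilon>"
    "\<And>j. j < length vs \<Longrightarrow> j \<noteq> p \<Longrightarrow> j \<noteq> q \<Longrightarrow> \<bar>d j\<bar> \<le> \<epsilon>" unfolding B[symmetric] by blast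
  note * = extreme_eigenvalues_isolated[OF P pq small, folded l_def m_def]
  show "Polynomial.order l (char_poly B) = 1" "Polynomial.order m (char_poly B) = 1"
    "\<bar>l - 1\<bar> \<le> \<epsilon>" "\<bar>m + 1\<bar> \<le> \<epsilon>" "\<And>x. x \<in> spectrum B - {l, m} \<Longrightarrow> \<bar>x\<bar> \<le> \<epsilon>"
    using * by blast+
qed

theorem corollary4p10:
  fixes G :: "'a pair_pre_digraph" and r :: 'a
    and vs :: "nat \<Rightarrow> 'a list list"
    and B :: "nat \<Rightarrow> real mat" and lam mu :: "nat \<Rightarrow> real"
  assumes "pair_graph G" and "r \<in> pverts G"
    and "out_degree (with_proj G) r \<ge> 1"
    and "\<And>N. N \<ge> 1 \<Longrightarrow> distinct (vs N) \<and> set (vs N) = pverts (fst (star_power (G, r) N))"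
  defines "B \<equiv> \<lambda>N. (real (out_degree (with_proj G) r * N) powr (- 1 / 2))
                     \<cdot>\<^sub>m adjacency_matrix (fst (star_power (G, r) N)) (vs N)"
    and "lam \<equiv> \<lambda>N. Max (spectrum (B N))"
    and "mu \<equiv> \<lambda>N. Min (spectrum (B N))"
  shows "(\<forall>\<^sub>F N in sequentially.
            Polynomial.order (lam N) (char_poly (B N)) = 1 \<and>
            Polynomial.order (mu N) (char_poly (B N)) = 1)
       \<and> (lam \<longlonglongrightarrow> 1 \<and> mu \<longlonglongrightarrow> -1)
       \<and> (\<lambda>N. let S = spectrum (B N) - {lam N, mu N}
               in if S = {} then 0 else Sup {\<bar>x\<bar> | x. x \<in> S}) \<longlonglongrightarrow> 0"
proof -
  interpret pair_graph G by fact
  define d where "d = card (parcs G `` {r})"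
  have "{e \<in> parcs G. fst e = r} = Pair r ` (parcs G `` {r})" by force
  hence deg: "out_degree (with_proj G) r = d"
    by (simp add: out_degree_def out_arcs_def d_def card_image inj_on_def)
  have d: "d \<ge> 1" using assms(3) deg by simp
  define \<epsilon> where "\<epsilon> N = card (pverts G) / sqrt (real (d * N))" for N
  have \<epsilon>0: "\<epsilon> \<longlonglongrightarrow> 0"
  proof -
    have "filterlim (\<lambda>N. sqrt (real (d * N))) at_top sequentially"
    proof (rule filterlim_compose[OF sqrt_at_top])
      have "filterlim (\<lambda>N. real d * real N) at_top sequentially"
        by (rule filterlim_tendsto_pos_mult_at_top[OF tendsto_const _ filterlim_real_sequentially])
           (use d in simp)
      thus "filterlim (\<lambda>N. real (d * N)) at_top sequentially" by simp
    qed
    thus ?thesis unfolding \<epsilon>_def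
      by (rule real_tendsto_divide_at_top[OF tendsto_const])
  qed
  have "\<forall>\<^sub>F N in sequentially. \<epsilon> N < 1 / 2" using \<epsilon>0 by (rule order_tendstoD) simp
  hence large: "\<forall>\<^sub>F N in sequentially. N \<ge> 1 \<and> 2 * \<epsilon> N < 1"
    using eventually_ge_at_top[of 1] by eventually_elim auto
  have main: "Polynomial.order (lam N) (char_poly (B N)) = 1"
      "Polynomial.order (mu N) (char_poly (B N)) = 1"
      "\<bar>lam N - 1\<bar> \<le> \<epsilon> N" "\<bar>mu N + 1\<bar> \<le> \<epsilon> N"
      "\<And>x. x \<in> spectrum (B N) - {lam N, mu N} \<Longrightarrow> \<bar>x\<bar> \<le> \<epsilon> N"
    if "N \<ge> 1 \<and> 2 * \<epsilon> N < 1" for N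
    using normalized_star_power_spectrum[of r "vs N" N] assms(2,4) that d
    unfolding lam_def mu_def B_def deg \<epsilon>_def d_def by blast+
  have "lam \<longlonglongrightarrow> 1"
  proof (rule LIM_zero_cancel)
    show "(\<lambda>N. lam N - 1) \<longlonglongrightarrow> 0"
    proof (rule tendsto_0_le[OF \<epsilon>0, where K = 1])
      show "\<forall>\<^sub>F N in sequentially. norm (lam N - 1) \<le> norm (\<epsilon> N) * 1"
        using large
      proof eventually_elim
        case (elim N)
        show ?case using main(3)[OF elim] by simp
      qed
    qed
  qed
  moreover have "mu \<longlonglongrightarrow> -1"
  proof (rule LIM_zero_cancel)
    show "(\<lambda>N. mu N - - 1) \<longlonglongrightarrow> 0"
    proof (rule tendsto_0_le[OF \<epsilon>0, where K = 1])
      show "\<forall>\<^sub>F N in sequentially. norm (mu N - - 1) \<le> norm (\<epsilon> N) * 1"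
        using large
      proof eventually_elim
        case (elim N)
        show ?case using main(4)[OF elim] by simp
      qed
    qed
  qed
  moreover have "(\<lambda>N. let S = spectrum (B N) - {lam N, mu N}
               in if S = {} then 0 else Sup {\<bar>x\<bar> | x. x \<in> S}) \<longlonglongrightarrow> 0" (is "?s \<longlonglongrightarrow> 0")
  proof (rule tendsto_0_le[OF \<epsilon>0, where K = 1])
    show "\<forall>\<^sub>F N in sequentially. norm (?s N) \<le> norm (\<epsilon> N) * 1"
      using large
    proof eventually_elim
      case (elim N)
      let ?S = "spectrum (B N) - {lam N, mu N}"
      have "\<epsilon> N \<ge> 0" by (simp add: \<epsilon>_def)
      moreover have "\<bar>Sup {\<bar>x\<bar> | x. x \<in> ?S}\<bar> \<le> \<epsilon> N" if "?S \<noteq> {}"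
        by (rule cSup_abs_le) (use that main(5)[OF elim] in auto)
      ultimately show ?case by (simp add: Let_def)
    qed
  qed
  moreover have "\<forall>\<^sub>F N in sequentially.
            Polynomial.order (lam N) (char_poly (B N)) = 1 \<and>
            Polynomial.order (mu N) (char_poly (B N)) = 1"
    using large by eventually_elim (use main in auto)
  ultimately show ?thesis by blast
qed

end
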